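(* Let $G$ be a graph with spanning tree $T$, and suppose there is an acyclic charging scheme from $G$ to $T$ of value $v$. Then for any $\epsilon>0$ and any nonnegative edge weighting $w$ on $G$, the greedy algorithm below outputs a $(1+\epsilon)$-spanner $G'$ of $G$ containing $T$ with $w(G')\le (1+v/\epsilon)\cdot w(T)$. The algorithm: set $G'=T$; for each edge $e=\{a,b\}\in G-T$ in nondecreasing order of $w(e)$, if $(1+\epsilon)w(e)<d_{G'}(a,b)$ then add $e$ to $G'$; return $G'$.
   Context: $d_H(a,b)$ denotes the shortest-path distance in a weighted graph $H$; a spanning subgraph $G'$ of $G$ is a $(1+\epsilon)$-spanner if $d_{G'}(a,b)\le(1+\epsilon)d_G(a,b)$ for all vertices $a,b$; $w(\cdot)$ denotes total edge weight. A detour in $G$ is a pair $(e,P)$ of an edge $e$ and a path $P$ such that $e+P$ is a simple cycle. A charging scheme assigns $x_{(e,P)}\ge 0$ to each detour; the move subtracts $x_{(e,P)}$ units of charge from $e$ and adds $x_{(e,P)}$ units to each edge of $P$ ("$e$ charges $P$" when $x_{(e,P)}>0$). With $\mathrm{Out}(e)=\sum_P x_{(e,P)}$, $\mathrm{In}(e)=\sum_{(e',P):\,e\in P}x_{(e',P)}$ and $\mathrm{Net}(e)=\mathrm{In}(e)-\mathrm{Out}(e)$, a charging scheme from $G$ to $T$ of value $v$ satisfies (1) $\mathrm{Out}(e)\ge1$ for $e\in G-T$; (2) $\mathrm{Net}(e)\le 0$ for $e\in G-T$; (3) $\mathrm{Net}(e)\le v$ for $e\in T$. It is acyclic if also (4)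 only edges of $G-T$ charge paths, and (5) there is an ordering of the edges such that whenever $e_1$ charges a path containing $e_2$, $e_1$ precedes $e_2$. *)

theory Defs
  imports Complex_Main "HOL-Library.Extended_Real"
begin

text \<open>Finite simple undirected graphs with vertex set \<open>V\<close> and edge set \<open>E\<close>; an edge is the
  two-element set of its end vertices. Spanning subgraphs of \<open>(V, E)\<close> are given by subsets of
  \<open>E\<close>.\<close>

definition simple_graph :: "'a set \<Rightarrow> 'a set set \<Rightarrow> bool" where
  "simple_graph V E \<longleftrightarrow>
     finite V \<and> (\<forall>e\<in>E. \<exists>a b. a \<in> V \<and> b \<in> V \<and> a \<noteq> b \<and> e = {a, b})"

fun walk_edges :: "'a list \<Rightarrow> 'a set set" where
  "walk_edges [] = {}"
| "walk_edges [a] = {}"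
| "walk_edges (a # b # p) = insert {a, b} (walk_edges (b # p))"

definition simple_path :: "'a set \<Rightarrow> 'a set set \<Rightarrow> 'a \<Rightarrow> 'a list \<Rightarrow> 'a \<Rightarrow> bool" where
  "simple_path V E a p b \<longleftrightarrow>
     p \<noteq> [] \<and> hd p = a \<and> last p = b \<and> distinct p \<and> set p \<subseteq> V \<and> walk_edges p \<subseteq> E"

definition simple_cycle_edges :: "'a set \<Rightarrow> 'a set set \<Rightarrow> 'a set set \<Rightarrow> bool" where
  "simple_cycle_edges V E C \<longleftrightarrow>
     (\<exists>p. length p \<ge> 3 \<and> distinct p \<and> set p \<subseteq> V \<and>
          C = insert {last p, hd p} (walk_edges p) \<and> C \<subseteq> E)"

definition spanning_tree_of :: "'a set \<Rightarrow> 'a set set \<Rightarrow> 'a set set \<Rightarrow> bool" where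
  "spanning_tree_of V E T \<longleftrightarrow>
     T \<subseteq> E \<and> (\<forall>a\<in>V. \<forall>b\<in>V. \<exists>p. simple_path V T a p b) \<and>
     \<not> (\<exists>C. simple_cycle_edges V T C)"

text \<open>The distance is \<open>\<infinity>\<close> between vertices that are not connected. The edges of a simple path
  are pairwise distinct, so summing over the edge set gives the weight of the path.\<close>

definition graph_dist :: "'a set \<Rightarrow> 'a set set \<Rightarrow> ('a set \<Rightarrow> real) \<Rightarrow> 'a \<Rightarrow> 'a \<Rightarrow> ereal" where
  "graph_dist V E w a b = (INF p \<in> {p. simple_path V E a p b}. ereal (sum w (walk_edges p)))"

definition is_spanner ::
    "'a set \<Rightarrow> 'a set set \<Rightarrow> ('a set \<Rightarrow> real) \<Rightarrow> real \<Rightarrow> 'a set set \<Rightarrow> bool" where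
  "is_spanner V E w t E' \<longleftrightarrow>
     E' \<subseteq> E \<and> (\<forall>a\<in>V. \<forall>b\<in>V. graph_dist V E' w a b \<le> ereal t * graph_dist V E w a b)"

text \<open>The path of a detour is recorded by its edge set, so that a path and its reversal are the
  same object.\<close>

definition detours :: "'a set \<Rightarrow> 'a set set \<Rightarrow> ('a set \<times> 'a set set) set" where
  "detours V E =
     {(e, P). e \<in> E \<and> (\<exists>a p b. simple_path V E a p b \<and> P = walk_edges p) \<and>
              e \<notin> P \<and> simple_cycle_edges V E (insert e P)}"

definition charge_out ::
    "'a set \<Rightarrow> 'a set set \<Rightarrow> ('a set \<times> 'a set set \<Rightarrow> real) \<Rightarrow> 'a set \<Rightarrow> real" where
  "charge_out V E x e = (\<Sum>P | (e, P) \<in> detours V E. x (e, P))"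

definition charge_in ::
    "'a set \<Rightarrow> 'a set set \<Rightarrow> ('a set \<times> 'a set set \<Rightarrow> real) \<Rightarrow> 'a set \<Rightarrow> real" where
  "charge_in V E x e = (\<Sum>d | d \<in> detours V E \<and> e \<in> snd d. x d)"

definition charge_net ::
    "'a set \<Rightarrow> 'a set set \<Rightarrow> ('a set \<times> 'a set set \<Rightarrow> real) \<Rightarrow> 'a set \<Rightarrow> real" where
  "charge_net V E x e = charge_in V E x e - charge_out V E x e"

definition charging_scheme ::
    "'a set \<Rightarrow> 'a set set \<Rightarrow> 'a set set \<Rightarrow> real \<Rightarrow> ('a set \<times> 'a set set \<Rightarrow> real) \<Rightarrow> bool" where
  "charging_scheme V E T v x \<longleftrightarrow>
     (\<forall>d \<in> detours V E. x d \<ge> 0) \<and>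
     (\<forall>e \<in> E - T. charge_out V E x e \<ge> 1) \<and>
     (\<forall>e \<in> E - T. charge_net V E x e \<le> 0) \<and>
     (\<forall>e \<in> T. charge_net V E x e \<le> v)"

definition acyclic_charging_scheme ::
    "'a set \<Rightarrow> 'a set set \<Rightarrow> 'a set set \<Rightarrow> real \<Rightarrow> ('a set \<times> 'a set set \<Rightarrow> real) \<Rightarrow> bool" where
  "acyclic_charging_scheme V E T v x \<longleftrightarrow>
     charging_scheme V E T v x \<and>
     (\<forall>(e, P) \<in> detours V E. x (e, P) > 0 \<longrightarrow> e \<in> E - T) \<and>
     (\<exists>r. strict_linear_order_on E r \<and>
          (\<forall>(e1, P) \<in> detours V E. x (e1, P) > 0 \<longrightarrow> (\<forall>e2 \<in> P. (e1, e2) \<in> r)))"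

text \<open>The list \<open>es\<close> is the order in which the edges outside \<open>T\<close> are examined. Since
  \<open>graph_dist\<close> is symmetric, the choice of \<open>a\<close> and \<open>b\<close> in the test is immaterial.\<close>

definition greedy_step ::
    "'a set \<Rightarrow> ('a set \<Rightarrow> real) \<Rightarrow> real \<Rightarrow> 'a set \<Rightarrow> 'a set set \<Rightarrow> 'a set set" where
  "greedy_step V w \<epsilon> e H =
     (if \<exists>a b. e = {a, b} \<and> ereal ((1 + \<epsilon>) * w e) < graph_dist V H w a b
      then insert e H else H)"

definition greedy_spanner ::
    "'a set \<Rightarrow> 'a set set \<Rightarrow> ('a set \<Rightarrow> real) \<Rightarrow> real \<Rightarrow> 'a set list \<Rightarrow> 'a set set" where
  "greedy_spanner V T w \<epsilon> es = fold (greedy_step V w \<epsilon>) es T"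

end

theory Submission
  imports Defs
begin

text \<open>Every non-tree edge \<open>e\<close> of a cycle in the greedy graph \<open>G'\<close> satisfies
  \<open>(1 + \<epsilon>) w(e) < w(C - e)\<close>: the greedy test gives this for the last edge of the cycle that was
  added, and that edge is a heaviest non-tree edge of the cycle.

  Let \<open>r\<close> be the ordering of an acyclic scheme \<open>x\<close>. Give an edge \<open>e = {a, b}\<close> outside \<open>G'\<close> the
  weight \<open>w'(e)\<close>, the distance from \<open>a\<close> to \<open>b\<close> along edges of \<open>G'\<close> that come after \<open>e\<close>, and put
  \<open>w' = w\<close> on \<open>G'\<close>. If \<open>e\<close> charges \<open>P\<close> then all edges of \<open>P\<close> come after \<open>e\<close>, so \<open>w'(P)\<close> is at
  least that distance. Hence \<open>w'(P) \<ge> w'(e)\<close> always, and \<open>w'(P) \<ge> (1 + \<epsilon>) w(e)\<close> if \<open>e\<close> lies in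
  \<open>G'\<close>, since the paths considered then avoid \<open>e\<close>. Summing \<open>x (w'(P) - w'(e))\<close> over all detours
  gives \<open>\<epsilon> w(G' - T) \<le> \<Sum> Net(e) w'(e) \<le> v w(T)\<close>.\<close>

section \<open>Paths and cycles\<close>

lemma walk_edges_Cons: "p \<noteq> [] \<Longrightarrow> walk_edges (a # p) = insert {a, hd p} (walk_edges p)"
  by (cases p) auto

lemma walk_edges_append:
  "p \<noteq> [] \<Longrightarrow> q \<noteq> [] \<Longrightarrow>
   walk_edges (p @ q) = insert {last p, hd q} (walk_edges p \<union> walk_edges q)"
  by (induction p rule: walk_edges.induct) (auto simp: walk_edges_Cons)

lemma walk_edges_rev [simp]: "walk_edges (rev p) = walk_edges p"
proof (induction p)
  case (Cons a p)
  then show ?case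
    by (cases "p = []") (auto simp: walk_edges_append walk_edges_Cons last_rev insert_commute)
qed simp

lemma finite_walk_edges [simp]: "finite (walk_edges p)"
  by (induction p rule: walk_edges.induct) auto

lemma walk_edge_subset_set: "e \<in> walk_edges p \<Longrightarrow> e \<subseteq> set p"
  by (induction p rule: walk_edges.induct) auto

lemma walk_edges_split:
  "e \<in> walk_edges p \<Longrightarrow> \<exists>xs c d ys. p = xs @ c # d # ys \<and> e = {c, d}"
proof (induction p rule: walk_edges.induct)
  case (3 a b p)
  show ?case
  proof (cases "e = {a, b}")
    case True
    then show ?thesis by (intro exI[of _ "[]"]) auto
  next
    case False
    with 3 obtain xs c d ys where "b # p = xs @ c # d # ys" "e = {c, d}"
      by auto
    then show ?thesis by (intro exI[of _ "a # xs"]) auto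
  qed
qed auto

text \<open>In a distinct list the first and last vertices occur once each, so they can be
  consecutive only if the list has two vertices.\<close>

lemma closing_edge_notin_walk_edges:
  assumes "distinct p" "length p \<ge> 3"
  shows "{last p, hd p} \<notin> walk_edges p"
proof
  assume "{last p, hd p} \<in> walk_edges p"
  then obtain xs c d ys where p: "p = xs @ c # d # ys" and e: "{last p, hd p} = {c, d}"
    using walk_edges_split by metis
  show False
    using assms e unfolding p
    by (cases xs; cases ys rule: rev_cases) (auto simp: doubleton_eq_iff)
qed

text \<open>Loop erasure by induction: the head is put in front of the simple walk found for the
  tail, and if it already occurs there, everything before that occurrence is dropped
  instead.\<close>

lemma distinct_subwalk:
  assumes "p \<noteq> []"
  shows "\<exists>q. q \<noteq> [] \<and> hd q = hd p \<and> last q = last p \<and> distinct q \<and> set q \<subseteq> set p \<and>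
    walk_edges q \<subseteq> walk_edges p"
  using assms
proof (induction p)
  case (Cons a p)
  show ?case
  proof (cases "p = []")
    case True
    then show ?thesis by (intro exI[of _ "[a]"]) auto
  next
    case False
    with Cons obtain q where q: "q \<noteq> []" "hd q = hd p" "last q = last p" "distinct q"
      "set q \<subseteq> set p" "walk_edges q \<subseteq> walk_edges p" by auto
    show ?thesis
    proof (cases "a \<in> set q")
      case True
      then obtain ys zs where yz: "q = ys @ a # zs"
        by (meson split_list)
      have "walk_edges (a # zs) \<subseteq> walk_edges q"
        unfolding yz by (cases "ys = []") (auto simp: walk_edges_append)
      with q False yz show ?thesis
        by (intro exI[of _ "a # zs"]) (auto simp: walk_edges_Cons)
    next
      case notin: False
      with q False show ?thesis
        by (intro exI[of _ "a # q"]) (auto simp: walk_edges_Cons)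
    qed
  qed
qed simp

lemma simple_path_trans:
  assumes "simple_path V E a p b" "simple_path V E b q c"
  obtains s where "simple_path V E a s c" "walk_edges s \<subseteq> walk_edges p \<union> walk_edges q"
proof -
  have p: "p \<noteq> []" "hd p = a" "last p = b" and q: "q \<noteq> []" "hd q = b" "last q = c"
    using assms by (auto simp: simple_path_def)
  \<comment> \<open>The head of \<open>q\<close> is \<open>b\<close>, already the last vertex of
    \<open>p\<close>, so only \<open>tl q\<close> is appended.\<close>
  have sub: "walk_edges (p @ tl q) \<subseteq> walk_edges p \<union> walk_edges q"
  proof (cases "tl q = []")
    case False
    then show ?thesis
      using p q walk_edges_Cons[of "tl q" b] walk_edges_append[of p "tl q"] by (cases q) auto
  qed auto
  have ends: "hd (p @ tl q) = a" "last (p @ tl q) = c"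
    using p q by (cases q; auto)+
  have "set (p @ tl q) \<subseteq> V"
    using assms by (auto simp: simple_path_def dest: list.set_sel(2))
  with distinct_subwalk[of "p @ tl q"] p ends sub obtain s where s: "s \<noteq> []" "hd s = a"
    "last s = c" "distinct s" "set s \<subseteq> V" "walk_edges s \<subseteq> walk_edges p \<union> walk_edges q"
    by (metis append_is_Nil_conv subset_trans)
  moreover have "walk_edges p \<union> walk_edges q \<subseteq> E"
    using assms by (auto simp: simple_path_def)
  ultimately show thesis
    by (intro that[of s]) (auto simp: simple_path_def)
qed

lemma simple_path_rev: "simple_path V E a p b \<Longrightarrow> simple_path V E b (rev p) a"
  by (auto simp: simple_path_def hd_rev last_rev)

lemma simple_path_mono: "simple_path V E a p b \<Longrightarrow> E \<subseteq> F \<Longrightarrow> simple_path V F a p b"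
  by (auto simp: simple_path_def)

lemma simple_path_Cons:
  "simple_path V E a (x # y # p) b \<longleftrightarrow>
     x = a \<and> a \<in> V \<and> a \<notin> set (y # p) \<and> {a, y} \<in> E \<and> simple_path V E y (y # p) b"
  by (auto simp: simple_path_def)

text \<open>A cycle can be rotated so that any chosen edge becomes its closing edge; the rotated
  list is then the path. This serves both detours and cycles of the greedy graph.\<close>

lemma simple_cycle_minus_edge:
  assumes "simple_cycle_edges V E C" "e \<in> C"
  obtains a b p where "e = {a, b}" "a \<noteq> b" "simple_path V (C - {e}) a p b"
proof -
  obtain p where p: "length p \<ge> 3" "distinct p" "set p \<subseteq> V"
    and C: "C = insert {last p, hd p} (walk_edges p)"
    using assms(1) unfolding simple_cycle_edges_def by blast
  have "\<exists>q. length q \<ge> 3 \<and> distinct q \<and> set q \<subseteq> V \<and> e = {last q, hd q} \<and> walk_edges q \<subseteq> C"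
  proof (cases "e = {last p, hd p}")
    case True
    with p C show ?thesis by blast
  next
    case False
    with assms(2) C obtain xs c d ys where s: "p = xs @ c # d # ys" "e = {c, d}"
      by (metis insertE walk_edges_split)
    \<comment> \<open>Cutting between \<open>c\<close> and \<open>d\<close> and swapping the halves
      makes \<open>e\<close> the closing edge, while the old closing edge becomes an inner
      one.\<close>
    let ?q = "(d # ys) @ (xs @ [c])"
    have "walk_edges p = insert {c, d} (walk_edges (xs @ [c]) \<union> walk_edges (d # ys))"
      using walk_edges_append[of "xs @ [c]" "d # ys"] s by simp
    moreover have "walk_edges ?q =
        insert {last p, hd p} (walk_edges (d # ys) \<union> walk_edges (xs @ [c]))"
      using walk_edges_append[of "d # ys" "xs @ [c]"] s by (cases xs) auto
    ultimately show ?thesis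
      using p s C by (intro exI[of _ ?q]) auto
  qed
  then obtain q where q: "length q \<ge> 3" "distinct q" "set q \<subseteq> V" "e = {last q, hd q}"
    "walk_edges q \<subseteq> C" by blast
  have "hd q \<noteq> last q"
    using q(1,2) by (cases q) (auto split: if_splits)
  moreover have "simple_path V (C - {e}) (hd q) q (last q)"
    using q closing_edge_notin_walk_edges[of q] by (auto simp: simple_path_def)
  ultimately show thesis
    using q(4) by (intro that[of "hd q" "last q" q]) auto
qed

text \<open>Since \<open>{a, b}\<close> is not in \<open>F\<close>, the path is not that edge alone,
  so it has the three vertices that a cycle requires.\<close>

lemma simple_cycle_insert_edge:
  assumes "simple_path V F a p b" "a \<noteq> b" "{a, b} \<notin> F" "insert {a, b} F \<subseteq> E"
  shows "simple_cycle_edges V E (insert {a, b} (walk_edges p))"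
proof -
  have p: "p \<noteq> []" "hd p = a" "last p = b" "distinct p" "set p \<subseteq> V" "walk_edges p \<subseteq> F"
    using assms(1) by (auto simp: simple_path_def)
  have "length p \<ge> 3"
  proof (rule ccontr)
    assume "\<not> length p \<ge> 3"
    then have "length p = 1 \<or> length p = 2"
      using p(1) by (simp flip: length_greater_0_conv) linarith
    then show False
      using p assms(2,3) by (auto simp: length_Suc_conv numeral_2_eq_2)
  qed
  then show ?thesis
    unfolding simple_cycle_edges_def
    using p assms(4) by (intro exI[of _ p]) (auto simp: insert_commute)
qed

section \<open>Distances\<close>

lemma graph_dist_le:
  "simple_path V E a p b \<Longrightarrow> graph_dist V E w a b \<le> ereal (sum w (walk_edges p))"
  unfolding graph_dist_def by (intro INF_lower) auto

text \<open>Simple paths are distinct lists over a finite vertex set, so there are finitely many and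
  the infimum is a minimum, unless there is no path at all and it is \<infinity>.\<close>

lemma graph_dist_attained:
  assumes "finite V" "graph_dist V E w a b \<noteq> \<infinity>"
  obtains p where "simple_path V E a p b" "graph_dist V E w a b = ereal (sum w (walk_edges p))"
proof -
  let ?S = "{p. simple_path V E a p b}"
  have "?S \<subseteq> {p. set p \<subseteq> V \<and> distinct p}"
    by (auto simp: simple_path_def)
  then have "finite ?S"
    using finite_subset_distinct[OF assms(1)] finite_subset by blast
  moreover have "?S \<noteq> {}"
  proof
    assume "?S = {}"
    then show False
      using assms(2) by (simp add: graph_dist_def top_ereal_def)
  qed
  ultimately have "graph_dist V E w a b \<in> (\<lambda>p. ereal (sum w (walk_edges p))) ` ?S"
    unfolding graph_dist_def
    using Min_in by (simp add: cInf_eq_Min)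
  then show thesis using that by auto
qed

lemma graph_dist_nonneg:
  assumes "\<And>e. e \<in> E \<Longrightarrow> w e \<ge> 0"
  shows "graph_dist V E w a b \<ge> 0"
  unfolding graph_dist_def
  by (intro INF_greatest) (use assms in \<open>auto simp: simple_path_def intro!: sum_nonneg\<close>)

lemma graph_dist_commute: "graph_dist V E w a b = graph_dist V E w b a"
proof (rule antisym)
  show "graph_dist V E w a b \<le> graph_dist V E w b a" for a b
    unfolding graph_dist_def[of V E w b a]
    by (rule INF_greatest) (use graph_dist_le[OF simple_path_rev] in fastforce)
  then show "graph_dist V E w b a \<le> graph_dist V E w a b" .
qed

lemma graph_dist_antimono:
  "E \<subseteq> F \<Longrightarrow> graph_dist V F w a b \<le> graph_dist V E w a b"
  unfolding graph_dist_def by (rule INF_superset_mono) (auto intro: simple_path_mono)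

lemma graph_dist_edge_le:
  "a \<in> V \<Longrightarrow> b \<in> V \<Longrightarrow> a \<noteq> b \<Longrightarrow> {a, b} \<in> E \<Longrightarrow> graph_dist V E w a b \<le> ereal (w {a, b})"
  using graph_dist_le[of V E a "[a, b]" b w] by (simp add: simple_path_def)

text \<open>Shortest paths are joined and loops erased. As weights are nonnegative, erasing edges
  and counting shared edges once can only lower the total.\<close>

lemma graph_dist_triangle:
  assumes "finite V" "\<And>e. e \<in> E \<Longrightarrow> w e \<ge> 0"
  shows "graph_dist V E w a c \<le> graph_dist V E w a b + graph_dist V E w b c"
proof (cases "graph_dist V E w a b = \<infinity> \<or> graph_dist V E w b c = \<infinity>")
  case True
  then show ?thesis by auto
next
  case False
  then obtain p q where p: "simple_path V E a p b"
      "graph_dist V E w a b = ereal (sum w (walk_edges p))"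
    and q: "simple_path V E b q c" "graph_dist V E w b c = ereal (sum w (walk_edges q))"
    using graph_dist_attained[OF assms(1)] by metis
  obtain s where s: "simple_path V E a s c" "walk_edges s \<subseteq> walk_edges p \<union> walk_edges q"
    using simple_path_trans[OF p(1) q(1)] .
  have E: "walk_edges p \<subseteq> E" "walk_edges q \<subseteq> E"
    using p(1) q(1) by (auto simp: simple_path_def)
  have "sum w (walk_edges s) \<le> sum w (walk_edges p \<union> walk_edges q)"
    by (rule sum_mono2) (use s E assms(2) in auto)
  also have "\<dots> \<le> sum w (walk_edges p) + sum w (walk_edges q)"
  proof -
    have "sum w (walk_edges p \<inter> walk_edges q) \<ge> 0"
      by (rule sum_nonneg) (use E assms(2) in auto)
    then show ?thesis
      using sum.union_inter[of "walk_edges p" "walk_edges q" w] by simp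
  qed
  finally show ?thesis
    using graph_dist_le[OF s(1), of w] p(2) q(2) by (simp add: order_trans)
qed

text \<open>The triangle inequality along a path. The path lies in \<open>F\<close>, the distances
  are taken in \<open>E\<close>, and \<open>c\<close> may be infinite; this covers the stretch
  bound, the finiteness of detour distances and their comparison with detour weights.\<close>

lemma graph_dist_le_path_sum:
  assumes "finite V" "\<And>e. e \<in> E \<Longrightarrow> w e \<ge> 0"
    and "\<And>a b. {a, b} \<in> F \<Longrightarrow> a \<noteq> b \<Longrightarrow> a \<in> V \<Longrightarrow> b \<in> V \<Longrightarrow> graph_dist V E w a b \<le> c {a, b}"
    and "simple_path V F a p b"
  shows "graph_dist V E w a b \<le> sum c (walk_edges p)"
  using assms(4)
proof (induction p arbitrary: a rule: walk_edges.induct)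
  case 1
  then show ?case by (simp add: simple_path_def)
next
  case (2 x)
  then have "x = a" "x = b" "a \<in> V" by (auto simp: simple_path_def)
  then show ?case
    using graph_dist_le[of V E a "[a]" a w] by (simp add: simple_path_def zero_ereal_def)
next
  case (3 x y p)
  then have *: "x = a" "a \<in> V" "a \<notin> set (y # p)" "{a, y} \<in> F" "simple_path V F y (y # p) b"
    by (auto simp: simple_path_Cons)
  \<comment> \<open>The vertex \<open>a\<close> does not recur, so the first edge is new and the sum
    over the edge set really gains a term.\<close>
  then have "y \<in> V" "{a, y} \<notin> walk_edges (y # p)"
    using walk_edge_subset_set[of "{a, y}" "y # p"] by (auto simp: simple_path_def)
  have "graph_dist V E w a b \<le> graph_dist V E w a y + graph_dist V E w y b"
    by (rule graph_dist_triangle[OF assms(1,2)])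
  also have "\<dots> \<le> c {a, y} + sum c (walk_edges (y # p))"
    by (intro add_mono assms(3) "3.IH") (use * \<open>y \<in> V\<close> in auto)
  also have "\<dots> = sum c (walk_edges (x # y # p))"
    using * \<open>{a, y} \<notin> _\<close> by simp
  finally show ?case .
qed

section \<open>The greedy algorithm\<close>

lemma greedy_spanner_snoc:
  "greedy_spanner V T w \<epsilon> (es @ [e]) = greedy_step V w \<epsilon> e (greedy_spanner V T w \<epsilon> es)"
  by (simp add: greedy_spanner_def)

lemma greedy_spanner_bounds:
  "T \<subseteq> greedy_spanner V T w \<epsilon> es \<and> greedy_spanner V T w \<epsilon> es \<subseteq> T \<union> set es"
proof (induction es rule: rev_induct)
  case Nil
  then show ?case by (simp add: greedy_spanner_def)
next
  case (snoc e es)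
  then show ?case by (auto simp: greedy_spanner_snoc greedy_step_def)
qed

text \<open>The edge failed the test at its turn, and edges added afterwards can only shorten
  distances.\<close>

lemma greedy_spanner_rejected:
  assumes "{a, b} \<in> set es" "{a, b} \<notin> greedy_spanner V T w \<epsilon> es"
  shows "graph_dist V (greedy_spanner V T w \<epsilon> es) w a b \<le> ereal ((1 + \<epsilon>) * w {a, b})"
  using assms
proof (induction es rule: rev_induct)
  case (snoc e es)
  let ?H = "greedy_spanner V T w \<epsilon> es" and ?H' = "greedy_spanner V T w \<epsilon> (es @ [e])"
  have sub: "?H \<subseteq> ?H'"
    by (auto simp: greedy_spanner_snoc greedy_step_def)
  have "graph_dist V ?H w a b \<le> ereal ((1 + \<epsilon>) * w {a, b})"
  proof (cases "{a, b} = e")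
    case True
    then show ?thesis
      using snoc.prems(2) unfolding greedy_spanner_snoc greedy_step_def
      by (metis insertI1 linorder_not_less)
  next
    case False
    then show ?thesis
      using snoc sub by auto
  qed
  then show ?case
    using graph_dist_antimono[OF sub] order_trans by blast
qed simp

text \<open>Adding \<open>w f\<close> to both sides of the inequality between
  \<open>(1 + \<epsilon>) * w f\<close> and the weight of the rest of \<open>C\<close> gives a right
  side independent of \<open>f\<close>. If the cycle needs the last examined edge, its other edges
  already joined the ends of that edge when it was tested.\<close>

lemma greedy_spanner_cycle:
  assumes "\<not> (\<exists>C. simple_cycle_edges V T C)" "\<epsilon> > 0" "\<And>e. e \<in> T \<union> set es \<Longrightarrow> w e \<ge> 0"
    and "sorted (map w es)"
    and "simple_cycle_edges V (greedy_spanner V T w \<epsilon> es) C" "f \<in> C" "f \<notin> T"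
  shows "(2 + \<epsilon>) * w f < sum w C"
  using assms(3-)
proof (induction es rule: rev_induct)
  case Nil
  then show ?case using assms(1) by (auto simp: greedy_spanner_def)
next
  case (snoc e es)
  let ?H = "greedy_spanner V T w \<epsilon> es"
  have C: "C \<subseteq> greedy_step V w \<epsilon> e ?H"
    using snoc.prems(3) by (auto simp: simple_cycle_edges_def greedy_spanner_snoc)
  show ?case
  proof (cases "C \<subseteq> ?H")
    case True
    then have "simple_cycle_edges V ?H C"
      using snoc.prems(3) by (auto simp: simple_cycle_edges_def)
    then show ?thesis
      using snoc.IH snoc.prems by (auto simp: sorted_append)
  next
    case False
    then have e: "e \<in> C" "C - {e} \<subseteq> ?H"
      and "\<exists>a b. e = {a, b} \<and> ereal ((1 + \<epsilon>) * w e) < graph_dist V ?H w a b"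
      using C by (auto simp: greedy_step_def split: if_splits)
    then obtain a b where ab: "e = {a, b}" "ereal ((1 + \<epsilon>) * w e) < graph_dist V ?H w a b"
      by blast
    have CE: "C \<subseteq> T \<union> set (es @ [e])"
      using snoc.prems(3) greedy_spanner_bounds[of T V w \<epsilon> "es @ [e]"]
      by (auto simp: simple_cycle_edges_def)
    have finC: "finite C"
      using snoc.prems(3) by (auto simp: simple_cycle_edges_def)
    obtain c d p where p: "e = {c, d}" "simple_path V (C - {e}) c p d"
      using simple_cycle_minus_edge[OF snoc.prems(3) e(1)] by metis
    \<comment> \<open>The greedy test and the opened cycle may name the ends of \<open>e\<close> in
      opposite orders.\<close>
    have "graph_dist V ?H w a b = graph_dist V ?H w c d"
      using ab(1) p(1) graph_dist_commute by (metis doubleton_eq_iff)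
    also have "\<dots> \<le> ereal (sum w (walk_edges p))"
      by (rule graph_dist_le[OF simple_path_mono[OF p(2) e(2)]])
    also have "sum w (walk_edges p) \<le> sum w (C - {e})"
      by (rule sum_mono2) (use p(2) finC CE snoc.prems(1) in \<open>auto simp: simple_path_def\<close>)
    finally have "(1 + \<epsilon>) * w e < sum w (C - {e})"
      using ab(2) by (meson ereal_less_eq(3) less_ereal.simps(1) order_less_le_trans)
    moreover have "sum w C = w e + sum w (C - {e})"
      using finC e(1) by (rule sum.remove)
    \<comment> \<open>As \<open>f\<close> is not in \<open>T\<close>, it is an examined edge, and
      the edges are examined in nondecreasing weight.\<close>
    moreover have "w f \<le> w e"
      using snoc.prems CE by (auto simp: sorted_append)
    then have "(2 + \<epsilon>) * w f \<le> (2 + \<epsilon>) * w e"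
      using assms(2) by simp
    ultimately show ?thesis
      by (simp add: algebra_simps)
  qed
qed

lemma finite_edges: "simple_graph V E \<Longrightarrow> finite E"
  by (rule finite_subset[of _ "Pow V"]) (auto simp: simple_graph_def)

text \<open>It suffices to bound each edge of a shortest path: a kept edge is its own connection,
  and a rejected one is handled by the failed test.\<close>

lemma greedy_is_spanner:
  assumes "simple_graph V E" "T \<subseteq> E" "\<epsilon> > 0" "\<And>e. e \<in> E \<Longrightarrow> w e \<ge> 0" "set es = E - T"
  shows "is_spanner V E w (1 + \<epsilon>) (greedy_spanner V T w \<epsilon> es)"
proof -
  let ?H = "greedy_spanner V T w \<epsilon> es"
  have V: "finite V" using assms(1) by (simp add: simple_graph_def)
  have H: "T \<subseteq> ?H" "?H \<subseteq> E"
    using greedy_spanner_bounds[of T V w \<epsilon> es] assms(2,5) by auto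
  have edge: "graph_dist V ?H w a b \<le> ereal ((1 + \<epsilon>) * w {a, b})"
    if "{a, b} \<in> E" "a \<noteq> b" "a \<in> V" "b \<in> V" for a b
  proof (cases "{a, b} \<in> ?H")
    case True
    then have "graph_dist V ?H w a b \<le> ereal (w {a, b})"
      using that graph_dist_edge_le by metis
    also have "w {a, b} \<le> (1 + \<epsilon>) * w {a, b}"
      using assms(3,4) that(1) by (simp add: algebra_simps)
    finally show ?thesis by simp
  next
    case False
    then show ?thesis
      using greedy_spanner_rejected that(1) assms(5) H(1) by (metis DiffI subsetD)
  qed
  have "graph_dist V ?H w a b \<le> ereal (1 + \<epsilon>) * graph_dist V E w a b" for a b
  proof (cases "graph_dist V E w a b = \<infinity>")
    case True
    then show ?thesis using assms(3) by simp
  next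
    case False
    then obtain p where p: "simple_path V E a p b"
        "graph_dist V E w a b = ereal (sum w (walk_edges p))"
      using graph_dist_attained[OF V] by metis
    have "graph_dist V ?H w a b \<le> (\<Sum>e\<in>walk_edges p. ereal ((1 + \<epsilon>) * w e))"
      by (rule graph_dist_le_path_sum[OF V _ _ p(1)]) (use H(2) assms(4) edge in auto)
    then show ?thesis
      by (simp add: p(2) sum_distrib_left)
  qed
  with H(2) show ?thesis by (simp add: is_spanner_def)
qed

section \<open>Detour weights\<close>

text \<open>The infimum over both orders of the ends avoids choosing one; by symmetry both give the
  same distance.\<close>

definition edge_dist :: "'a set \<Rightarrow> 'a set set \<Rightarrow> ('a set \<Rightarrow> real) \<Rightarrow> 'a set \<Rightarrow> ereal" where
  "edge_dist V H w e = (INF (a, b) \<in> {(a, b). e = {a, b}}. graph_dist V H w a b)"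

lemma edge_dist_eq [simp]: "edge_dist V H w {a, b} = graph_dist V H w a b"
proof -
  have "{(c, d). {a, b} = {c, d}} = {(a, b), (b, a)}"
    by (auto simp: doubleton_eq_iff)
  then show ?thesis
    by (simp add: edge_dist_def graph_dist_commute[of V H w b a])
qed

definition later :: "('b \<times> 'b) set \<Rightarrow> 'b set \<Rightarrow> 'b \<Rightarrow> 'b set" where
  "later r H e = {f \<in> H. (e, f) \<in> r}"

text \<open>This is the weight \<open>w'\<close> of the overview. \<open>real_of_ereal\<close> would
  turn \<infinity> into 0, which \<open>edge_dist_later_finite\<close> excludes for the edges
  concerned.\<close>

definition detour_weight ::
    "'a set \<Rightarrow> 'a set set \<Rightarrow> ('a set \<times> 'a set) set \<Rightarrow> ('a set \<Rightarrow> real) \<Rightarrow> 'a set \<Rightarrow> real" where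
  "detour_weight V H r w e =
     (if e \<in> H then w e else real_of_ereal (edge_dist V (later r H e) w e))"

lemma later_antimono: "trans r \<Longrightarrow> (e, f) \<in> r \<Longrightarrow> later r H f \<subseteq> later r H e"
  by (auto simp: later_def dest: transD)

text \<open>A detour stores \<open>P\<close> without endpoints, so a path joining the ends of
  \<open>e\<close> is recovered by opening the cycle at \<open>e\<close>. It is only claimed to lie
  inside \<open>P\<close>.\<close>

lemma detour_path:
  assumes "(e, P) \<in> detours V E"
  obtains a b p where "e = {a, b}" "a \<noteq> b" "simple_path V P a p b"
proof -
  have "simple_cycle_edges V E (insert e P)" "e \<notin> P"
    using assms by (auto simp: detours_def)
  then show thesis
    using simple_cycle_minus_edge[of V E "insert e P" e] that by (metis Diff_insert_absorb insertI1)
qed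

lemma detours_subset: "detours V E \<subseteq> E \<times> Pow E"
  by (auto simp: detours_def simple_path_def)

text \<open>Induction on the number of edges after \<open>e\<close>: each edge of a detour of
  \<open>e\<close> that is missing from \<open>H\<close> is replaced by its own connection along
  later edges, which also come after \<open>e\<close> by transitivity.\<close>

lemma edge_dist_later_finite:
  assumes G: "simple_graph V E" and H: "T \<subseteq> H" "H \<subseteq> E" and w: "\<And>e. e \<in> E \<Longrightarrow> w e \<ge> 0"
    and r: "trans r" "irrefl r"
    and out: "\<And>e. e \<in> E - T \<Longrightarrow> \<exists>P. (e, P) \<in> detours V E \<and> (\<forall>f\<in>P. (e, f) \<in> r)"
    and e: "e \<in> E - T"
  shows "edge_dist V (later r H e) w e < \<infinity>"
  using e
proof (induction "card {f \<in> E. (e, f) \<in> r}" arbitrary: e rule: less_induct)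
  case less
  have V: "finite V" using G by (simp add: simple_graph_def)
  obtain P where P: "(e, P) \<in> detours V E" "\<And>f. f \<in> P \<Longrightarrow> (e, f) \<in> r"
    using out less.prems by blast
  then have PE: "P \<subseteq> E" using detours_subset by blast
  obtain a b p where p: "e = {a, b}" "simple_path V P a p b"
    using detour_path[OF P(1)] by metis
  let ?A = "later r H e"
  have step: "edge_dist V ?A w f < \<infinity>" if f: "f \<in> P" for f
  proof -
    obtain c d where cd: "f = {c, d}" "c \<in> V" "d \<in> V" "c \<noteq> d"
      using f PE G unfolding simple_graph_def by blast
    show ?thesis
    proof (cases "f \<in> H")
      case True
      then have "graph_dist V ?A w c d \<le> ereal (w f)"
        using cd graph_dist_edge_le[of c V d ?A w] P(2)[OF f] by (auto simp: later_def)
      then show ?thesis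
        using cd by (auto simp: le_less_trans)
    next
      case False
      \<comment> \<open>Strict because \<open>f\<close> comes after \<open>e\<close> but not after
        itself.\<close>
      have "{g \<in> E. (f, g) \<in> r} \<subset> {g \<in> E. (e, g) \<in> r}"
        using P(2)[OF f] r f PE by (auto simp: irrefl_def dest: transD)
      then have "card {g \<in> E. (f, g) \<in> r} < card {g \<in> E. (e, g) \<in> r}"
        using finite_edges[OF G] by (intro psubset_card_mono) auto
      then have "edge_dist V (later r H f) w f < \<infinity>"
        using less.hyps f PE False H(1) by blast
      then show ?thesis
        using graph_dist_antimono[OF later_antimono[OF r(1) P(2)[OF f]]] cd(1)
        by (metis edge_dist_eq le_less_trans)
    qed
  qed
  have "graph_dist V ?A w a b \<le> (\<Sum>f\<in>walk_edges p. edge_dist V ?A w f)"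
    by (rule graph_dist_le_path_sum[OF V _ _ p(2)]) (use w H(2) in \<open>auto simp: later_def\<close>)
  moreover have "(\<Sum>f\<in>walk_edges p. edge_dist V ?A w f) \<noteq> \<infinity>"
    using p(2) step by (fastforce simp: sum_Pinfty simple_path_def)
  ultimately show ?case
    using p(1) by auto
qed

lemma edge_dist_nonneg:
  assumes "\<And>e. e \<in> H \<Longrightarrow> w e \<ge> 0"
  shows "edge_dist V H w e \<ge> 0"
  unfolding edge_dist_def by (intro INF_greatest) (use graph_dist_nonneg[of H w] assms in auto)

lemma detour_weight_nonneg:
  assumes "\<And>e. e \<in> H \<Longrightarrow> w e \<ge> 0"
  shows "detour_weight V H r w e \<ge> 0"
  using assms edge_dist_nonneg[of "later r H e" w V e]
  by (auto simp: detour_weight_def later_def intro: real_of_ereal_pos)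

text \<open>An edge \<open>f\<close> of \<open>P\<close> that is in \<open>H\<close> may be used
  directly; otherwise its weight is a distance along edges after \<open>f\<close>, all of which come
  after \<open>e\<close>. Adding up along the path gives the bound.\<close>

lemma edge_dist_later_le_detour_weight:
  assumes G: "simple_graph V E" and H: "T \<subseteq> H" "H \<subseteq> E" and w: "\<And>e. e \<in> E \<Longrightarrow> w e \<ge> 0"
    and r: "trans r" "irrefl r"
    and out: "\<And>e. e \<in> E - T \<Longrightarrow> \<exists>P. (e, P) \<in> detours V E \<and> (\<forall>f\<in>P. (e, f) \<in> r)"
    and P: "(e, P) \<in> detours V E" "\<And>f. f \<in> P \<Longrightarrow> (e, f) \<in> r"
  shows "edge_dist V (later r H e) w e \<le> ereal (sum (detour_weight V H r w) P)"
proof -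
  have V: "finite V" using G by (simp add: simple_graph_def)
  let ?A = "later r H e"
  have PE: "P \<subseteq> E" using P detours_subset by blast
  obtain a b p where p: "e = {a, b}" "simple_path V P a p b"
    using detour_path[OF P(1)] by metis
  have edge: "graph_dist V ?A w c d \<le> ereal (detour_weight V H r w {c, d})"
    if "{c, d} \<in> P" "c \<noteq> d" "c \<in> V" "d \<in> V" for c d
  proof (cases "{c, d} \<in> H")
    case True
    then show ?thesis
      using graph_dist_edge_le[of c V d ?A w] that P(2) by (simp add: detour_weight_def later_def)
  next
    case False
    let ?B = "later r H {c, d}"
    have "edge_dist V ?B w {c, d} < \<infinity>"
      by (rule edge_dist_later_finite[OF G H w r out]) (use False that PE H in auto)
    moreover have "edge_dist V ?B w {c, d} \<ge> 0"
      by (rule edge_dist_nonneg) (use w H(2) in \<open>auto simp: later_def\<close>)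
    \<comment> \<open>Finite and nonnegative, so \<open>real_of_ereal\<close> loses nothing.\<close>
    ultimately have "ereal (detour_weight V H r w {c, d}) = graph_dist V ?B w c d"
      using False by (simp add: detour_weight_def ereal_real')
    then show ?thesis
      using graph_dist_antimono[OF later_antimono[OF r(1) P(2)[OF that(1)]]] by metis
  qed
  have "edge_dist V ?A w e \<le> (\<Sum>f\<in>walk_edges p. ereal (detour_weight V H r w f))"
    unfolding p(1) edge_dist_eq
    by (rule graph_dist_le_path_sum[OF V _ _ p(2)])
      (use w H(2) edge p(1) in \<open>auto simp: later_def\<close>)
  also have "\<dots> = ereal (sum (detour_weight V H r w) (walk_edges p))"
    by simp
  also have "sum (detour_weight V H r w) (walk_edges p) \<le> sum (detour_weight V H r w) P"
  proof (rule sum_mono2)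
    show "finite P"
      using PE finite_edges[OF G] by (rule finite_subset)
    show "walk_edges p \<subseteq> P"
      using p(2) by (simp add: simple_path_def)
    show "detour_weight V H r w f \<ge> 0" for f
      by (rule detour_weight_nonneg) (use w H(2) in auto)
  qed
  finally show ?thesis by simp
qed

section \<open>Summing the charges\<close>

lemma sum_detours_fst:
  assumes "finite E"
  shows "(\<Sum>d\<in>detours V E. x d * k (fst d)) = (\<Sum>e\<in>E. charge_out V E x e * k e)"
proof -
  have "detours V E = Sigma E (\<lambda>e. {P. (e, P) \<in> detours V E})"
    using detours_subset by fastforce
  moreover have "finite {P. (e, P) \<in> detours V E}" for e
    by (rule finite_subset[of _ "Pow E"]) (use detours_subset assms in blast)+
  ultimately have "(\<Sum>d\<in>detours V E. x d * k (fst d)) =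
      (\<Sum>e\<in>E. \<Sum>P | (e, P) \<in> detours V E. x (e, P) * k e)"
    using sum.Sigma[of E "\<lambda>e. {P. (e, P) \<in> detours V E}" "\<lambda>e P. x (e, P) * k e"] assms
    by (simp add: case_prod_unfold)
  then show ?thesis
    by (simp add: charge_out_def sum_distrib_right)
qed

text \<open>Double counting of the pairs of a detour and an edge on its path.\<close>

lemma sum_detours_snd:
  assumes "finite E"
  shows "(\<Sum>d\<in>detours V E. x d * sum k (snd d)) = (\<Sum>e\<in>E. charge_in V E x e * k e)"
proof -
  have fin: "finite (detours V E)"
    using detours_subset by (rule finite_subset) (use assms in auto)
  have "(\<Sum>d\<in>detours V E. x d * sum k (snd d)) =
      (\<Sum>d\<in>detours V E. \<Sum>e | e \<in> E \<and> e \<in> snd d. x d * k e)"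
  proof (rule sum.cong)
    fix d assume "d \<in> detours V E"
    then have "{e. e \<in> E \<and> e \<in> snd d} = snd d"
      using detours_subset[of V E] by fastforce
    then show "x d * sum k (snd d) = (\<Sum>e | e \<in> E \<and> e \<in> snd d. x d * k e)"
      by (simp add: sum_distrib_left)
  qed simp
  also have "\<dots> = (\<Sum>e\<in>E. \<Sum>d | d \<in> detours V E \<and> e \<in> snd d. x d * k e)"
    using fin assms by (rule sum.swap_restrict)
  finally show ?thesis
    by (simp add: charge_in_def sum_distrib_right)
qed

text \<open>The sum of \<open>x (e, P) * (sum u P - u e)\<close> over all detours is bounded below
  through \<open>gain\<close> and the outgoing charges, and above through the net charges.\<close>

lemma charging_weight_bound:
  assumes "finite E" "T \<subseteq> H" "H \<subseteq> E" "charging_scheme V E T v x"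
    and w: "\<And>e. e \<in> E \<Longrightarrow> w e \<ge> 0" "\<And>e. e \<in> E \<Longrightarrow> u e \<ge> 0" "\<And>e. e \<in> H \<Longrightarrow> u e = w e"
    and "\<epsilon> > 0"
    and gain: "\<And>e P. (e, P) \<in> detours V E \<Longrightarrow> x (e, P) > 0 \<Longrightarrow>
        (if e \<in> H - T then \<epsilon> * w e else 0) \<le> sum u P - u e"
  shows "sum w H \<le> (1 + v / \<epsilon>) * sum w T"
proof -
  let ?k = "\<lambda>e. if e \<in> H - T then \<epsilon> * w e else 0"
  have x: "\<And>d. d \<in> detours V E \<Longrightarrow> x d \<ge> 0"
    and net: "\<And>e. e \<in> E - T \<Longrightarrow> charge_net V E x e \<le> 0" "\<And>e. e \<in> T \<Longrightarrow> charge_net V E x e \<le> v"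
    and out: "\<And>e. e \<in> E - T \<Longrightarrow> charge_out V E x e \<ge> 1"
    using assms(4) by (auto simp: charging_scheme_def)
  have "\<epsilon> * sum w (H - T) = (\<Sum>e\<in>E. ?k e)"
    using assms(1,3) by (simp add: sum_distrib_left) (rule sum.mono_neutral_cong_left; auto)
  also have "\<dots> \<le> (\<Sum>e\<in>E. charge_out V E x e * ?k e)"
  proof (rule sum_mono)
    fix e assume "e \<in> E"
    then show "?k e \<le> charge_out V E x e * ?k e"
      using mult_right_mono[OF out, of e "\<epsilon> * w e"] w(1) assms(8) by auto
  qed
  also have "\<dots> = (\<Sum>d\<in>detours V E. x d * ?k (fst d))"
    by (rule sum_detours_fst[OF assms(1), symmetric])
  \<comment> \<open>Detours with zero charge contribute nothing, so \<open>gain\<close> is needed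
    only where \<open>x\<close> is positive.\<close>
  also have "\<dots> \<le> (\<Sum>d\<in>detours V E. x d * (sum u (snd d) - u (fst d)))"
  proof (rule sum_mono)
    fix d assume d: "d \<in> detours V E"
    show "x d * ?k (fst d) \<le> x d * (sum u (snd d) - u (fst d))"
      using gain[of "fst d" "snd d"] d x[OF d]
      by (cases "x d = 0") (auto intro!: mult_left_mono simp del: mult_le_cancel_left)
  qed
  also have "\<dots> = (\<Sum>e\<in>E. charge_net V E x e * u e)"
    using sum_detours_fst[OF assms(1), where V = V and x = x and k = u]
      sum_detours_snd[OF assms(1), where V = V and x = x and k = u]
    by (simp add: charge_net_def right_diff_distrib left_diff_distrib sum_subtractf)
  \<comment> \<open>Edges outside \<open>T\<close> have nonpositive net charge and nonnegative
    \<open>u\<close>; on \<open>T\<close>, \<open>u\<close> agrees with \<open>w\<close>.\<close>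
  also have "\<dots> \<le> (\<Sum>e\<in>E. if e \<in> T then v * w e else 0)"
  proof (rule sum_mono)
    fix e assume "e \<in> E"
    then show "charge_net V E x e * u e \<le> (if e \<in> T then v * w e else 0)"
      using mult_right_mono[OF net(2), of e "w e"] net(1)[of e] w assms(2)
      by (auto intro: mult_nonpos_nonneg)
  qed
  also have "\<dots> = v * sum w T"
    using assms(1,2,3) by (simp add: sum_distrib_left sum.inter_restrict[symmetric] Int_absorb1)
  finally have "sum w (H - T) \<le> v / \<epsilon> * sum w T"
    using assms(8) by (simp add: field_simps)
  moreover have "sum w H = sum w (H - T) + sum w T"
    using assms(1-3) by (intro sum.subset_diff) (auto intro: finite_subset)
  ultimately show ?thesis by (simp add: algebra_simps)
qed

section \<open>Applying the charging bound to the detour weights\<close>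

theorem theorem2:
  fixes V :: "'a set" and E T :: "'a set set"
    and v \<epsilon> :: real and w :: "'a set \<Rightarrow> real" and es :: "'a set list"
  assumes "simple_graph V E"
    and "spanning_tree_of V E T"
    and "\<exists>x. acyclic_charging_scheme V E T v x"
    and "\<epsilon> > 0"
    and "\<forall>e\<in>E. w e \<ge> 0"
    and "distinct es" and "set es = E - T" and "sorted (map w es)"
  shows "is_spanner V E w (1 + \<epsilon>) (greedy_spanner V T w \<epsilon> es) \<and>
         T \<subseteq> greedy_spanner V T w \<epsilon> es \<and>
         sum w (greedy_spanner V T w \<epsilon> es) \<le> (1 + v / \<epsilon>) * sum w T"
proof -
  let ?H = "greedy_spanner V T w \<epsilon> es"
  have T: "T \<subseteq> E" "\<not> (\<exists>C. simple_cycle_edges V T C)"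
    using assms(2) by (auto simp: spanning_tree_of_def)
  have w: "\<And>e. e \<in> E \<Longrightarrow> w e \<ge> 0" using assms(5) by blast
  have H: "T \<subseteq> ?H" "?H \<subseteq> E"
    using greedy_spanner_bounds[of T V w \<epsilon> es] T(1) assms(7) by auto
  obtain x where acyclic: "acyclic_charging_scheme V E T v x"
    using assms(3) by blast
  then have x: "charging_scheme V E T v x"
    and charger: "\<And>e P. (e, P) \<in> detours V E \<Longrightarrow> x (e, P) > 0 \<Longrightarrow> e \<in> E - T"
    unfolding acyclic_charging_scheme_def by blast+
  obtain r where r: "trans r" "irrefl r"
    and order: "\<And>e P f. (e, P) \<in> detours V E \<Longrightarrow> x (e, P) > 0 \<Longrightarrow> f \<in> P \<Longrightarrow> (e, f) \<in> r"
    using acyclic unfolding acyclic_charging_scheme_def strict_linear_order_on_def by fast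
  \<comment> \<open>An outgoing charge of at least 1 forces a detour with positive charge, and
    acyclicity places its path after \<open>e\<close>.\<close>
  have out: "\<exists>P. (e, P) \<in> detours V E \<and> (\<forall>f\<in>P. (e, f) \<in> r)" if "e \<in> E - T" for e
  proof -
    have "charge_out V E x e > 0"
      using x that by (force simp: charging_scheme_def)
    then obtain P where "(e, P) \<in> detours V E" "x (e, P) > 0"
      unfolding charge_out_def by (metis (no_types, lifting) mem_Collect_eq not_less sum_nonpos)
    then show ?thesis using order by blast
  qed
  let ?u = "detour_weight V ?H r w"
  have "(if e \<in> ?H - T then \<epsilon> * w e else 0) \<le> sum ?u P - ?u e"
    if d: "(e, P) \<in> detours V E" "x (e, P) > 0" for e P
  proof -
    let ?A = "later r ?H e"
    have V: "finite V" using assms(1) by (simp add: simple_graph_def)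
    have le: "edge_dist V ?A w e \<le> ereal (sum ?u P)"
      by (rule edge_dist_later_le_detour_weight[OF assms(1) H w r out d(1) order[OF d]])
    have e: "e \<in> E - T" using charger d by blast
    have ge0: "edge_dist V ?A w e \<ge> 0"
      by (rule edge_dist_nonneg) (use w H(2) in \<open>auto simp: later_def\<close>)
    show ?thesis
    proof (cases "e \<in> ?H")
      \<comment> \<open>No strict gain is required here, and the weight of \<open>e\<close> is
        exactly this distance, finite by \<open>le\<close>.\<close>
      case False
      then show ?thesis
        using le ge0 by (cases "edge_dist V ?A w e") (auto simp: detour_weight_def)
    next
      case True
      obtain a b where ab: "e = {a, b}" "a \<noteq> b"
        using detour_path[OF d(1)] by metis
      have "graph_dist V ?A w a b \<noteq> \<infinity>"
        using le ab(1) by auto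
      then obtain q where q: "simple_path V ?A a q b"
          "graph_dist V ?A w a b = ereal (sum w (walk_edges q))"
        using graph_dist_attained[OF V] by metis
      \<comment> \<open>Irreflexivity keeps \<open>e\<close> off the path \<open>q\<close> of later
        edges, so \<open>e\<close> and \<open>q\<close> close a cycle in the greedy graph.\<close>
      have notin: "e \<notin> ?A"
        using r(2) by (auto simp: later_def irrefl_def)
      have cyc: "simple_cycle_edges V ?H (insert e (walk_edges q))"
        unfolding ab(1)
        by (rule simple_cycle_insert_edge[OF q(1)[unfolded ab(1)]])
          (use ab True notin in \<open>auto simp: later_def\<close>)
      have "(2 + \<epsilon>) * w e < sum w (insert e (walk_edges q))"
        by (rule greedy_spanner_cycle[OF T(2) assms(4) _ assms(8) cyc])
          (use w T(1) assms(7) e in auto)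
      also have "\<dots> = w e + sum w (walk_edges q)"
        using notin q(1) by (subst sum.insert) (auto simp: simple_path_def)
      \<comment> \<open>The weight of \<open>e\<close> is \<open>w e\<close> in this case, so a
        detour of weight at least \<open>(1 + \<epsilon>) * w e\<close> gains
        \<open>\<epsilon> * w e\<close>.\<close>
      finally show ?thesis
        using le q(2) ab(1) True e by (simp add: detour_weight_def algebra_simps)
    qed
  qed
  moreover have "\<And>e. e \<in> E \<Longrightarrow> ?u e \<ge> 0"
    by (rule detour_weight_nonneg) (use w H(2) in auto)
  moreover have "\<And>e. e \<in> ?H \<Longrightarrow> ?u e = w e"
    by (simp add: detour_weight_def)
  ultimately have "sum w ?H \<le> (1 + v / \<epsilon>) * sum w T"
    using charging_weight_bound[OF finite_edges[OF assms(1)] H x _ _ _ assms(4),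
        where w = w and u = ?u] w
    by blast
  then show ?thesis
    using greedy_is_spanner[OF assms(1) T(1) assms(4) _ assms(7), of w] w H(1) by blast
qed

end
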